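(* Let $X$ be a set, let $\mathcal{L}$ be a Lattice of subsets of $X$ containing $\emptyset$ and $X$, let $\sigma(\mathcal{L})$ be the Lattice $\sigma$-algebra generated by $\mathcal{L}$, and let $\nu$ be a signed Lattice measure on $(X,\sigma(\mathcal{L}))$. Then there exist a positive Lattice $A\in\sigma(\mathcal{L})$ and a negative Lattice $B\in\sigma(\mathcal{L})$ such that $A\vee B = X$ and $\nu(A\wedge B)=0$.
   Context: Lattices. Throughout, "Lattice" means a complete lattice $(L,\wedge,\vee)$ with order $\le$, minimum $0$ and maximum $I$, equipped with an operator $x\mapsto x^C$, satisfying the commutative, associative and absorption laws; the distributive laws $x\vee(y\wedge z)=(x\vee y)\wedge(x\vee z)$ and $x\wedge(y\vee z)=(x\wedge y)\vee(x\wedge z)$; the law of excluded middle $x\vee x^C=I$; the law of contrapositive $x\le y\Rightarrow x^C\ge y^C$; and the law of double negation $(x^C)^C=x$. The law of non-contradiction $x\wedge x^C=0$ is not included among the axioms. Here the elements are subsets of $X$, the minimum $0$ is $\emptyset$ and the maximum $I$ is $X$; the operations $\wedge,\vee,{}^C$ and the order $\le$ are those of the Lattice. Lattice $\sigma$-algebra. A Lattice $\mathcal{L}$ of subsets of $X$ is a Lattice $\sigma$-algebra if (1) $h\in\mathcal{L}$ implies $h^C\in\mathcal{L}$; and (2) $h_n\in\mathcal{L}$ for $n=1,2,3,\dots$ implies $\bigvee_{n=1}^\infty h_n\in\mathcal{L}$. $\sigma(\mathcal{L})$ denotes the Lattice $\sigma$-algebra generated by $\mathcal{L}$. Elements of $\sigma(\mathcal{L})$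 are called measurable Lattices (so the word "Lattice" is also used for an individual element). Signed Lattice measure. A signed Lattice measure on $(X,\sigma(\mathcal{L}))$ is a map $\nu:\sigma(\mathcal{L})\to\mathbb{R}\cup\{\infty\}$ or $\nu:\sigma(\mathcal{L})\to\mathbb{R}\cup\{-\infty\}$ such that: (1) $\nu(\emptyset)=\nu(0)=0$; (2) for all $h,g\in\sigma(\mathcal{L})$ with $\nu(h),\nu(g)\ge 0$: $h\le g\Rightarrow\nu(h)\le\nu(g)$; and for all $h,g\in\sigma(\mathcal{L})$ with $\nu(h),\nu(g)\le 0$: $h\le g\Rightarrow\nu(g)\le\nu(h)$; (3) for all $h,g\in\sigma(\mathcal{L})$: $\nu(h\vee g)+\nu(h\wedge g)=\nu(h)+\nu(g)$; (4) if $h_n\in\sigma(\mathcal{L})$, $n\in\mathbb{N}$, with $h_1\le h_2\le\cdots\le h_n\le\cdots$, then $\nu(\bigvee_{n=1}^\infty h_n)=\lim_{n\to\infty}\nu(h_n)$, in the sense that if the left side is finite the limit converges to it, and if the left side is $\pm\infty$ the limit diverges accordingly. Positive and negative Lattices. $A\in\sigma(\mathcal{L})$ is a positive Lattice if $\nu(E)\ge 0$ for every $E\in\sigma(\mathcal{L})$ with $E\le A$. $B\in\sigma(\mathcal{L})$ is a negative Lattice if $\nu(E)\le 0$ for every $E\in\sigma(\mathcal{L})$ with $E\le B$. *)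

theory Defs
  imports "HOL-Algebra.Complete_Lattice" "HOL-Analysis.Extended_Real_Limits"
begin

record 'a compl_order = "'a gorder" +
  compl :: "'a \<Rightarrow> 'a"

text \<open>
  The commutative, associative and absorption laws hold in every \<^locale>\<open>complete_lattice\<close>.
  The law of non-contradiction is not assumed.
\<close>

locale compl_lattice = complete_lattice M for M (structure) +
  assumes compl_closed: "x \<in> carrier M \<Longrightarrow> compl M x \<in> carrier M"
    and join_meet_distrib:
      "\<lbrakk>x \<in> carrier M; y \<in> carrier M; z \<in> carrier M\<rbrakk>
        \<Longrightarrow> x \<squnion> (y \<sqinter> z) = (x \<squnion> y) \<sqinter> (x \<squnion> z)"
    and meet_join_distrib:
      "\<lbrakk>x \<in> carrier M; y \<in> carrier M; z \<in> carrier M\<rbrakk>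
        \<Longrightarrow> x \<sqinter> (y \<squnion> z) = (x \<sqinter> y) \<squnion> (x \<sqinter> z)"
    and excluded_middle: "x \<in> carrier M \<Longrightarrow> x \<squnion> compl M x = \<top>"
    and contrapositive:
      "\<lbrakk>x \<in> carrier M; y \<in> carrier M; x \<sqsubseteq> y\<rbrakk> \<Longrightarrow> compl M y \<sqsubseteq> compl M x"
    and double_negation: "x \<in> carrier M \<Longrightarrow> compl M (compl M x) = x"

text \<open>
  A Lattice whose elements are subsets of \<open>X\<close>. Its order and its operations are those of the
  structure \<open>M\<close>; they need not be inclusion, union, intersection and set complement.
\<close>

locale set_compl_lattice = compl_lattice M for M :: "('a set, 'm) compl_order_scheme" (structure) +
  fixes X :: "'a set"
  assumes carrier_subset: "carrier M \<subseteq> Pow X"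
    and bottom_eq: "\<bottom> = {}"
    and top_eq: "\<top> = X"

text \<open>
  A Lattice of subsets of \<open>X\<close> whose operations are those of \<open>M\<close>. It is not required to be closed
  under complements or infinite joins, as otherwise the generated Lattice \<open>\<sigma>\<close>-algebra would
  add nothing to it. The choice \<open>S = carrier M\<close> is allowed.
\<close>

definition lattice_of_sets ::
  "('a set, 'm) compl_order_scheme \<Rightarrow> 'a set \<Rightarrow> 'a set set \<Rightarrow> bool" where
  "lattice_of_sets M X S \<longleftrightarrow>
     S \<subseteq> carrier M \<and> {} \<in> S \<and> X \<in> S \<and>
     (\<forall>h\<in>S. \<forall>g\<in>S. h \<squnion>\<^bsub>M\<^esub> g \<in> S \<and> h \<sqinter>\<^bsub>M\<^esub> g \<in> S)"

definition lattice_sigma_algebra ::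
  "('a set, 'm) compl_order_scheme \<Rightarrow> 'a set \<Rightarrow> 'a set set \<Rightarrow> bool" where
  "lattice_sigma_algebra M X S \<longleftrightarrow>
     lattice_of_sets M X S \<and>
     (\<forall>h\<in>S. compl M h \<in> S) \<and>
     (\<forall>h :: nat \<Rightarrow> 'a set. range h \<subseteq> S \<longrightarrow> \<Squnion>\<^bsub>M\<^esub> (range h) \<in> S)"

definition lattice_sigma ::
  "('a set, 'm) compl_order_scheme \<Rightarrow> 'a set \<Rightarrow> 'a set set \<Rightarrow> 'a set set" where
  "lattice_sigma M X L = \<Inter>{S. lattice_sigma_algebra M X S \<and> L \<subseteq> S}"

definition signed_lattice_measure ::
  "('a set, 'm) compl_order_scheme \<Rightarrow> 'a set set \<Rightarrow> ('a set \<Rightarrow> ereal) \<Rightarrow> bool" where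
  "signed_lattice_measure M \<Sigma> \<nu> \<longleftrightarrow>
     ((\<forall>h\<in>\<Sigma>. \<nu> h \<noteq> -\<infinity>) \<or> (\<forall>h\<in>\<Sigma>. \<nu> h \<noteq> \<infinity>)) \<and>
     \<nu> {} = 0 \<and>
     (\<forall>h\<in>\<Sigma>. \<forall>g\<in>\<Sigma>. 0 \<le> \<nu> h \<longrightarrow> 0 \<le> \<nu> g \<longrightarrow> h \<sqsubseteq>\<^bsub>M\<^esub> g \<longrightarrow> \<nu> h \<le> \<nu> g) \<and>
     (\<forall>h\<in>\<Sigma>. \<forall>g\<in>\<Sigma>. \<nu> h \<le> 0 \<longrightarrow> \<nu> g \<le> 0 \<longrightarrow> h \<sqsubseteq>\<^bsub>M\<^esub> g \<longrightarrow> \<nu> g \<le> \<nu> h) \<and>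
     (\<forall>h\<in>\<Sigma>. \<forall>g\<in>\<Sigma>. \<nu> (h \<squnion>\<^bsub>M\<^esub> g) + \<nu> (h \<sqinter>\<^bsub>M\<^esub> g) = \<nu> h + \<nu> g) \<and>
     (\<forall>h :: nat \<Rightarrow> 'a set. range h \<subseteq> \<Sigma> \<longrightarrow> (\<forall>n. h n \<sqsubseteq>\<^bsub>M\<^esub> h (Suc n)) \<longrightarrow>
        (\<lambda>n. \<nu> (h n)) \<longlonglongrightarrow> \<nu> (\<Squnion>\<^bsub>M\<^esub> (range h)))"

definition positive_lattice ::
  "('a set, 'm) compl_order_scheme \<Rightarrow> 'a set set \<Rightarrow> ('a set \<Rightarrow> ereal) \<Rightarrow> 'a set \<Rightarrow> bool" where
  "positive_lattice M \<Sigma> \<nu> A \<longleftrightarrow> A \<in> \<Sigma> \<and> (\<forall>E\<in>\<Sigma>. E \<sqsubseteq>\<^bsub>M\<^esub> A \<longrightarrow> 0 \<le> \<nu> E)"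

definition negative_lattice ::
  "('a set, 'm) compl_order_scheme \<Rightarrow> 'a set set \<Rightarrow> ('a set \<Rightarrow> ereal) \<Rightarrow> 'a set \<Rightarrow> bool" where
  "negative_lattice M \<Sigma> \<nu> B \<longleftrightarrow> B \<in> \<Sigma> \<and> (\<forall>E\<in>\<Sigma>. E \<sqsubseteq>\<^bsub>M\<^esub> B \<longrightarrow> \<nu> E \<le> 0)"

lemma (in set_compl_lattice) lattice_sigma_algebra_carrier:
  "lattice_sigma_algebra M X (carrier M)"
  unfolding lattice_sigma_algebra_def lattice_of_sets_def
proof (intro conjI ballI allI impI)
  show "{} \<in> carrier M"
    using bottom_closed by (simp only: bottom_eq)
  show "X \<in> carrier M"
    using top_closed by (simp only: top_eq)
qed (simp_all only: subset_refl join_closed meet_closed sup_closed compl_closed)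

lemma (in set_compl_lattice) lattice_sigma_algebra_lattice_sigma:
  assumes "L \<subseteq> carrier M"
  shows "lattice_sigma_algebra M X (lattice_sigma M X L)"
proof -
  let ?F = "{S. lattice_sigma_algebra M X S \<and> L \<subseteq> S}"
  have carr: "carrier M \<in> ?F"
    using lattice_sigma_algebra_carrier assms by simp
  have F: "{} \<in> S" "X \<in> S"
    "\<And>h g. h \<in> S \<Longrightarrow> g \<in> S \<Longrightarrow> h \<squnion> g \<in> S" "\<And>h g. h \<in> S \<Longrightarrow> g \<in> S \<Longrightarrow> h \<sqinter> g \<in> S"
    "\<And>h. h \<in> S \<Longrightarrow> compl M h \<in> S"
    "\<And>h :: nat \<Rightarrow> 'a set. range h \<subseteq> S \<Longrightarrow> \<Squnion> (range h) \<in> S"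
    if "S \<in> ?F" for S
    using that unfolding lattice_sigma_algebra_def lattice_of_sets_def by simp_all
  show ?thesis
    unfolding lattice_sigma_def lattice_sigma_algebra_def[of M X "\<Inter>?F"]
      lattice_of_sets_def[of M X "\<Inter>?F"]
  proof (intro conjI ballI allI impI)
    show "\<Inter>?F \<subseteq> carrier M"
      using carr by (rule Inter_lower)
  next
    fix h :: "nat \<Rightarrow> 'a set"
    assume "range h \<subseteq> \<Inter>?F"
    then show "\<Squnion> (range h) \<in> \<Inter>?F"
      by (intro InterI F(6)) (assumption, erule subset_trans, erule Inter_lower)
  qed (rule InterI, rule F; (assumption | erule (1) InterD))+
qed

end

(*
  Excluded middle, contraposition and double negation force non-contradiction, so M is a Boolean
  algebra and A can be sought as the complement of B. Suppose nu omits the value minus infinity.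
  If h and g are disjoint with nu h > 0 > nu g, then comparing h or g with their join by the
  monotonicity axiom gives nu h = infinity. Hence every element of negative measure is already a
  negative Lattice. If such elements exist, joining a minimising sequence of them yields an element
  B whose measure is the infimum of nu; its complement is then positive. If nu omits infinity, pass
  to - nu.
*)

theory Submission
  imports Defs
begin

section \<open>Boolean algebra laws derived from the complement axioms\<close>

context compl_lattice
begin

lemma compl_top: "compl M \<top> = \<bottom>"
proof -
  have "\<top> \<sqsubseteq> compl M \<bottom>"
    using contrapositive[of \<bottom> "compl M \<top>"] double_negation[of \<top>] compl_closed[of \<top>] by simp
  then have "compl M \<bottom> = \<top>"
    using compl_closed[of \<bottom>] by (simp add: le_antisym)
  then show ?thesis
    using double_negation[of \<bottom>] by simp
qed

text \<open>Since \<open>x \<sqinter> compl M x\<close> lies below both \<open>x\<close> and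
  \<open>compl M x\<close>, contraposition puts both of these below its complement. By excluded
  middle that complement is \<open>\<top>\<close>, and complementing once more gives
  \<open>\<bottom>\<close>.\<close>

lemma meet_compl:
  assumes "x \<in> carrier M"
  shows "x \<sqinter> compl M x = \<bottom>"
proof -
  let ?z = "x \<sqinter> compl M x"
  have c: "compl M x \<in> carrier M" "?z \<in> carrier M" "compl M ?z \<in> carrier M"
    using assms by (simp_all add: compl_closed)
  have "compl M x \<sqsubseteq> compl M ?z"
    using assms c by (intro contrapositive meet_left)
  moreover have "x \<sqsubseteq> compl M ?z"
    using contrapositive[of ?z "compl M x"] meet_right[of x "compl M x"] assms c
    by (simp add: double_negation)
  ultimately have "\<top> \<sqsubseteq> compl M ?z"
    using join_le[of x "compl M ?z" "compl M x"] excluded_middle assms c by simp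
  then have "compl M ?z = \<top>"
    using c by (simp add: le_antisym)
  then show ?thesis
    using double_negation[OF c(2)] compl_top by simp
qed

lemma disjoint_mono:
  assumes "x \<sqinter> y = \<bottom>" "z \<sqsubseteq> y"
    and "x \<in> carrier M" "y \<in> carrier M" "z \<in> carrier M"
  shows "x \<sqinter> z = \<bottom>"
proof -
  have "x \<sqinter> z \<sqsubseteq> x \<sqinter> y"
    using assms by (meson le_trans meet_closed meet_le meet_left meet_right)
  then show ?thesis
    using assms by (simp add: le_antisym)
qed

text \<open>The element \<open>y \<sqinter> compl M x\<close> plays the role of the set difference,
  so that a measure can be split along \<open>x \<sqsubseteq> y\<close> by additivity.\<close>

lemma relative_compl:
  assumes "x \<in> carrier M" "y \<in> carrier M" "x \<sqsubseteq> y"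
  shows "x \<squnion> (y \<sqinter> compl M x) = y" "x \<sqinter> (y \<sqinter> compl M x) = \<bottom>"
proof -
  have c: "compl M x \<in> carrier M"
    using assms by (simp add: compl_closed)
  have "x \<squnion> y = y"
    using assms le_iff_meet by blast
  then show "x \<squnion> (y \<sqinter> compl M x) = y"
    using assms c top_meet[of y]
    by (simp add: join_meet_distrib excluded_middle eq_is_equal meet_comm)
  show "x \<sqinter> (y \<sqinter> compl M x) = \<bottom>"
    using assms c meet_compl[of x] disjoint_mono[of x "compl M x"] by (simp add: meet_right)
qed

end

section \<open>Signed Lattice measures on a Lattice sigma-algebra\<close>

locale signed_lattice_measure_space = set_compl_lattice +
  fixes S :: "'a set set" and \<nu> :: "'a set \<Rightarrow> ereal"
  assumes sigma_algebra: "lattice_sigma_algebra M X S"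
    and measure: "signed_lattice_measure M S \<nu>"
begin

lemma carrierI: "h \<in> S \<Longrightarrow> h \<in> carrier M"
  using sigma_algebra by (auto simp: lattice_sigma_algebra_def lattice_of_sets_def)

lemma S_closed:
  shows "\<bottom> \<in> S" "\<top> \<in> S"
    and "h \<in> S \<Longrightarrow> g \<in> S \<Longrightarrow> h \<squnion> g \<in> S"
    and "h \<in> S \<Longrightarrow> g \<in> S \<Longrightarrow> h \<sqinter> g \<in> S"
    and "h \<in> S \<Longrightarrow> compl M h \<in> S"
    and "range f \<subseteq> S \<Longrightarrow> \<Squnion> (range (f :: nat \<Rightarrow> 'a set)) \<in> S"
  using sigma_algebra
  by (simp_all add: lattice_sigma_algebra_def lattice_of_sets_def bottom_eq top_eq)

lemma measure_bottom: "\<nu> \<bottom> = 0"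
  using measure by (simp add: signed_lattice_measure_def bottom_eq)

lemma measure_mono:
  "h \<in> S \<Longrightarrow> g \<in> S \<Longrightarrow> 0 \<le> \<nu> h \<Longrightarrow> 0 \<le> \<nu> g \<Longrightarrow> h \<sqsubseteq> g \<Longrightarrow> \<nu> h \<le> \<nu> g"
  using measure by (simp add: signed_lattice_measure_def)

lemma measure_antimono:
  "h \<in> S \<Longrightarrow> g \<in> S \<Longrightarrow> \<nu> h \<le> 0 \<Longrightarrow> \<nu> g \<le> 0 \<Longrightarrow> h \<sqsubseteq> g \<Longrightarrow> \<nu> g \<le> \<nu> h"
  using measure by (simp add: signed_lattice_measure_def)

lemma measure_modular:
  "h \<in> S \<Longrightarrow> g \<in> S \<Longrightarrow> \<nu> (h \<squnion> g) + \<nu> (h \<sqinter> g) = \<nu> h + \<nu> g"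
  using measure by (simp add: signed_lattice_measure_def)

lemma measure_continuous:
  "range h \<subseteq> S \<Longrightarrow> (\<And>n. h n \<sqsubseteq> h (Suc n)) \<Longrightarrow> (\<lambda>n. \<nu> (h n)) \<longlonglongrightarrow> \<nu> (\<Squnion> (range h))"
  for h :: "nat \<Rightarrow> 'a set"
  using measure by (simp add: signed_lattice_measure_def)

lemma measure_disjoint:
  "h \<in> S \<Longrightarrow> g \<in> S \<Longrightarrow> h \<sqinter> g = \<bottom> \<Longrightarrow> \<nu> (h \<squnion> g) = \<nu> h + \<nu> g"
  using measure_modular[of h g] measure_bottom by simp

lemma hahn_pairI:
  assumes "positive_lattice M S \<nu> A" "negative_lattice M S \<nu> B" "A \<squnion> B = \<top>" "A \<sqinter> B = \<bottom>"
  shows "\<exists>A B. positive_lattice M S \<nu> A \<and> negative_lattice M S \<nu> B \<and>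
           A \<squnion> B = X \<and> \<nu> (A \<sqinter> B) = 0"
  using assms measure_bottom top_eq by metis

end

text \<open>This fixes which infinity is omitted; the opposite case is reached by instantiating the
  locale with the negated measure.\<close>

locale lower_finite_measure_space = signed_lattice_measure_space +
  assumes not_MInfty: "h \<in> S \<Longrightarrow> \<nu> h \<noteq> -\<infinity>"
begin

text \<open>If both values were finite, the measure of the join would lie strictly between
  \<open>\<nu> g\<close> and \<open>\<nu> h\<close>. A nonnegative value contradicts monotonicity
  for \<open>h\<close>, a negative one contradicts antitonicity for \<open>g\<close>.\<close>

lemma disjoint_positive_infinite:
  assumes "h \<in> S" "g \<in> S" "h \<sqinter> g = \<bottom>" "0 < \<nu> h" "\<nu> g < 0"
  shows "\<nu> h = \<infinity>"
proof (rule ccontr)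
  assume "\<nu> h \<noteq> \<infinity>"
  have join: "\<nu> (h \<squnion> g) = \<nu> h + \<nu> g"
    using assms by (intro measure_disjoint)
  obtain a where a: "\<nu> h = ereal a"
    using \<open>\<nu> h \<noteq> \<infinity>\<close> assms not_MInfty by (cases "\<nu> h") auto
  obtain b where b: "\<nu> g = ereal b"
    using not_MInfty[OF \<open>g \<in> S\<close>] assms(5) by (cases "\<nu> g") auto
  have hg: "h \<squnion> g \<in> S" "h \<sqsubseteq> h \<squnion> g" "g \<sqsubseteq> h \<squnion> g"
    using assms by (simp_all add: S_closed carrierI join_left join_right)
  show False
  proof (cases "0 \<le> \<nu> (h \<squnion> g)")
    case True
    then have "\<nu> h \<le> \<nu> (h \<squnion> g)"
      using assms hg by (intro measure_mono) auto
    then show False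
      using join a b assms by simp
  next
    case False
    then have "\<nu> (h \<squnion> g) \<le> \<nu> g"
      using assms hg by (intro measure_antimono) auto
    then show False
      using join a b assms by simp
  qed
qed

text \<open>If a part \<open>e\<close> of \<open>f\<close> had positive measure, the rest of
  \<open>f\<close> would have negative measure. This forces \<open>\<nu> e = \<infinity>\<close>,
  and then \<open>\<nu> f = \<infinity>\<close> because the rest does not have measure
  \<open>-\<infinity>\<close>.\<close>

lemma negative_measure_imp_negative_lattice:
  assumes f: "f \<in> S" "\<nu> f < 0"
  shows "negative_lattice M S \<nu> f"
  unfolding negative_lattice_def
proof (intro conjI ballI impI)
  fix e
  assume e: "e \<in> S" "e \<sqsubseteq> f"
  let ?d = "f \<sqinter> compl M e"
  have d: "?d \<in> S" "e \<squnion> ?d = f" "e \<sqinter> ?d = \<bottom>"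
    using f e relative_compl[of e f] by (simp_all add: S_closed carrierI)
  have sum: "\<nu> f = \<nu> e + \<nu> ?d"
    using measure_disjoint[of e ?d] e d by simp
  show "\<nu> e \<le> 0"
  proof (rule ccontr)
    assume "\<not> \<nu> e \<le> 0"
    then have pos: "0 < \<nu> e"
      by simp
    have "\<nu> ?d < 0"
    proof (rule ccontr)
      assume "\<not> \<nu> ?d < 0"
      then have "0 \<le> \<nu> e + \<nu> ?d"
        using pos by (intro add_nonneg_nonneg) auto
      then show False
        using sum f by simp
    qed
    then have "\<nu> e = \<infinity>"
      using disjoint_positive_infinite e d pos by blast
    then show False
      using sum f not_MInfty[OF d(1)] by (simp add: plus_ereal.simps)
  qed
qed (fact f)

text \<open>The meet lies below the negative Lattice \<open>g\<close>, hence
  \<open>\<nu> g \<le> \<nu> (g \<sqinter> f) \<le> 0\<close>. All values on the right of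
  \<open>\<nu> (g \<squnion> f) = \<nu> f + (\<nu> g - \<nu> (g \<sqinter> f))\<close> are finite,
  and the bracket is at most 0.\<close>

lemma measure_join_le:
  assumes "g \<in> S" "f \<in> S" "\<nu> g < 0" "\<nu> f < 0"
  shows "\<nu> (g \<squnion> f) \<le> \<nu> f"
proof -
  have m: "g \<sqinter> f \<in> S" "g \<sqinter> f \<sqsubseteq> g"
    using assms by (simp_all add: S_closed carrierI meet_left)
  then have "\<nu> (g \<sqinter> f) \<le> 0"
    using negative_measure_imp_negative_lattice[of g] assms by (simp add: negative_lattice_def)
  moreover from this have "\<nu> g \<le> \<nu> (g \<sqinter> f)"
    using assms m by (intro measure_antimono) auto
  ultimately show ?thesis
    using measure_modular[of g f] assms m not_MInfty[of g] not_MInfty[of f] not_MInfty[of "g \<sqinter> f"]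
    by (cases "\<nu> g"; cases "\<nu> f"; cases "\<nu> (g \<sqinter> f)"; cases "\<nu> (g \<squnion> f)") auto
qed

lemma minimal_measure_exists:
  assumes "f0 \<in> S" "\<nu> f0 < 0"
  obtains B where "B \<in> S" "\<nu> B < 0" "\<And>h. h \<in> S \<Longrightarrow> \<nu> B \<le> \<nu> h"
proof -
  let ?N = "{h \<in> S. \<nu> h < 0}"
  have "\<nu> ` ?N \<noteq> {}"
    using assms by auto
  \<comment> \<open>The infimum is not yet known to be finite; a sequence of attained values with
    the same infimum exists in either case.\<close>
  then obtain u :: "nat \<Rightarrow> ereal" where u: "range u \<subseteq> \<nu> ` ?N" "Inf (\<nu> ` ?N) = (INF n. u n)"
    using Inf_countable_INF[of "\<nu> ` ?N"] by blast
  have "\<exists>h. h \<in> S \<and> \<nu> h < 0 \<and> \<nu> h = u n" for n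
    using subsetD[OF u(1) rangeI[of u n]] by auto
  then obtain f where f: "\<And>n. f n \<in> S" "\<And>n. \<nu> (f n) < 0" "\<And>n. \<nu> (f n) = u n"
    by metis
  \<comment> \<open>Finite joins turn the minimising sequence into an increasing chain, as the
    continuity axiom requires, without losing the bound \<open>u n\<close>.\<close>
  define g where "g = rec_nat (f 0) (\<lambda>n h. h \<squnion> f (Suc n))"
  have g_simps: "g 0 = f 0" "g (Suc n) = g n \<squnion> f (Suc n)" for n
    by (simp_all add: g_def)
  have g: "g n \<in> S \<and> \<nu> (g n) < 0" for n
  proof (induction n)
    case (Suc n)
    then show ?case
      using f measure_join_le[of "g n" "f (Suc n)"]
      by (auto simp: g_simps S_closed intro: le_less_trans)
  qed (simp add: g_simps f(1,2))
  have incr: "g n \<sqsubseteq> g (Suc n)" for n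
    using f g by (simp add: g_simps carrierI join_left)
  have "\<nu> (g n) \<le> u n" for n
    \<comment> \<open>The predecessor matters only for successors; at 0 the bound holds because
      \<open>g 0 = f 0\<close>.\<close>
    using measure_join_le[of "g (n - 1)" "f n"] f g by (cases n) (auto simp: g_simps)
  \<comment> \<open>Antitonicity applies since every \<open>\<nu> (g n)\<close> is negative; the
    limit \<open>\<nu> ?B\<close> is therefore below every term.\<close>
  have "decseq (\<lambda>n. \<nu> (g n))"
    using g incr by (intro decseq_SucI measure_antimono) (auto intro: less_imp_le)
  let ?B = "\<Squnion> (range g)"
  have B: "?B \<in> S"
    using g by (intro S_closed) auto
  have "(\<lambda>n. \<nu> (g n)) \<longlonglongrightarrow> \<nu> ?B"
    using g incr by (intro measure_continuous) auto
  then have "\<nu> ?B \<le> \<nu> (g n)" for n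
    using \<open>decseq (\<lambda>n. \<nu> (g n))\<close> decseq_ge by blast
  then have le_u: "\<nu> ?B \<le> u n" for n
    using \<open>\<And>n. \<nu> (g n) \<le> u n\<close> order_trans by blast
  have neg: "\<nu> ?B < 0"
    using le_u[of 0] f(2,3)[of 0] by simp
  have "\<nu> ?B \<le> Inf (\<nu> ` ?N)"
    using le_u by (simp add: u(2) INF_greatest)
  then have "\<nu> ?B \<le> \<nu> h" if "h \<in> S" for h
    using that neg by (cases "\<nu> h < 0") (auto simp: le_Inf_iff)
  then show thesis
    using that B neg by blast
qed

lemma hahn_decomposition:
  "\<exists>A B. positive_lattice M S \<nu> A \<and> negative_lattice M S \<nu> B \<and>
     A \<squnion> B = X \<and> \<nu> (A \<sqinter> B) = 0"
proof (cases "\<exists>f\<in>S. \<nu> f < 0")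
  case True
  then obtain B where B: "B \<in> S" "\<nu> B < 0" "\<And>h. h \<in> S \<Longrightarrow> \<nu> B \<le> \<nu> h"
    using minimal_measure_exists by metis
  have c: "B \<in> carrier M" "compl M B \<in> S" "compl M B \<in> carrier M"
    using B by (simp_all add: carrierI S_closed)
  have "positive_lattice M S \<nu> (compl M B)"
    unfolding positive_lattice_def
  proof (intro conjI ballI impI)
    fix E
    assume E: "E \<in> S" "E \<sqsubseteq> compl M B"
    then have "B \<sqinter> E = \<bottom>"
      using c disjoint_mono[of B "compl M B" E] meet_compl by (simp add: carrierI)
    \<comment> \<open>Minimality is applied to \<open>B \<squnion> E\<close>. As
      \<open>\<nu> B\<close> is negative but not \<open>-\<infinity>\<close>, it is finite and can
      be cancelled.\<close>
    then have "\<nu> B \<le> \<nu> B + \<nu> E"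
      using B(3)[of "B \<squnion> E"] measure_disjoint[of B E] B E by (simp add: S_closed)
    then show "0 \<le> \<nu> E"
      using B not_MInfty[of B] by (cases "\<nu> B"; cases "\<nu> E") auto
  qed (fact c)
  then show ?thesis
    using negative_measure_imp_negative_lattice[OF B(1,2)] excluded_middle[of B] meet_compl[of B] c
    by (intro hahn_pairI[of "compl M B" B]) (simp_all only: join_comm meet_comm)
next
  case False
  \<comment> \<open>With no negative values at all, the pair \<open>\<top>\<close>,
    \<open>\<bottom>\<close> works.\<close>
  then have "positive_lattice M S \<nu> \<top>"
    by (auto simp: positive_lattice_def S_closed not_less)
  moreover have "negative_lattice M S \<nu> \<bottom>"
    unfolding negative_lattice_def
    by (metis S_closed(1) bottom_closed bottom_lower carrierI le_antisym measure_bottom order_refl)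
  ultimately show ?thesis
    using top_join[of \<bottom>] bottom_meet[of \<top>]
    by (intro hahn_pairI[of \<top> \<bottom>]) (simp_all add: eq_is_equal meet_comm[of _ \<top>])
qed

end

section \<open>Change of sign and the general case\<close>

lemma (in signed_lattice_measure_space) signed_lattice_measure_uminus:
  "signed_lattice_measure M S (\<lambda>h. - \<nu> h)"
proof -
  note m = measure[unfolded signed_lattice_measure_def]
  \<comment> \<open>Negation does not distribute over a sum of opposite infinities in
    \<open>ereal\<close>; the case split succeeds because \<open>\<nu>\<close> omits one of them on
    \<open>S\<close>. The two monotonicity axioms simply trade places.\<close>
  have modular: "- \<nu> (h \<squnion> g) + - \<nu> (h \<sqinter> g) = - \<nu> h + - \<nu> g" if "h \<in> S" "g \<in> S" for h g
  proof -
    have "h \<squnion> g \<in> S" "h \<sqinter> g \<in> S"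
      using that by (simp_all add: S_closed)
    then show ?thesis
      using that m measure_modular[OF that]
      by (cases "\<nu> h"; cases "\<nu> g"; cases "\<nu> (h \<squnion> g)"; cases "\<nu> (h \<sqinter> g)") auto
  qed
  show ?thesis
    unfolding signed_lattice_measure_def
  proof (intro conjI ballI allI impI)
    show "(\<forall>h\<in>S. - \<nu> h \<noteq> -\<infinity>) \<or> (\<forall>h\<in>S. - \<nu> h \<noteq> \<infinity>)"
      using m by (auto simp: ereal_uminus_eq_reorder)
    show "- \<nu> {} = 0"
      using m by simp
  qed (simp_all add: measure_mono measure_antimono modular measure_continuous)
qed

theorem mainTheorem1:
  fixes M :: "('a set, 'm) compl_order_scheme"
    and X :: "'a set"
    and L :: "'a set set"
    and \<nu> :: "'a set \<Rightarrow> ereal"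
  assumes "set_compl_lattice M X"
    and "lattice_of_sets M X L"
    and "signed_lattice_measure M (lattice_sigma M X L) \<nu>"
  shows "\<exists>A B. positive_lattice M (lattice_sigma M X L) \<nu> A \<and>
               negative_lattice M (lattice_sigma M X L) \<nu> B \<and>
               A \<squnion>\<^bsub>M\<^esub> B = X \<and> \<nu> (A \<sqinter>\<^bsub>M\<^esub> B) = 0"
proof -
  let ?S = "lattice_sigma M X L"
  interpret set_compl_lattice M X
    by fact
  have "lattice_sigma_algebra M X ?S"
    using assms(2) by (intro lattice_sigma_algebra_lattice_sigma) (simp add: lattice_of_sets_def)
  then interpret signed_lattice_measure_space M X ?S \<nu>
    using assms(3) by unfold_locales
  consider "\<forall>h\<in>?S. \<nu> h \<noteq> -\<infinity>" | "\<forall>h\<in>?S. \<nu> h \<noteq> \<infinity>"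
    using measure unfolding signed_lattice_measure_def by blast
  then show ?thesis
  proof cases
    case 1
    then interpret lower_finite_measure_space M X ?S \<nu>
      by unfold_locales auto
    show ?thesis
      by (rule hahn_decomposition)
  next
    case 2
    interpret neg: lower_finite_measure_space M X ?S "\<lambda>h. - \<nu> h"
      using 2 sigma_algebra signed_lattice_measure_uminus by unfold_locales auto
    obtain A B where AB: "positive_lattice M ?S (\<lambda>h. - \<nu> h) A"
      "negative_lattice M ?S (\<lambda>h. - \<nu> h) B" "A \<squnion>\<^bsub>M\<^esub> B = X" "- \<nu> (A \<sqinter>\<^bsub>M\<^esub> B) = 0"
      using neg.hahn_decomposition by blast
    \<comment> \<open>Undoing the sign change exchanges positive and negative Lattices, so
      \<open>B\<close> and \<open>A\<close> swap roles.\<close>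
    then have "positive_lattice M ?S \<nu> B" "negative_lattice M ?S \<nu> A"
      by (simp_all add: positive_lattice_def negative_lattice_def)
    moreover have "B \<squnion>\<^bsub>M\<^esub> A = X" "\<nu> (B \<sqinter>\<^bsub>M\<^esub> A) = 0"
      using AB(3,4) by (simp_all add: join_comm[of _ B] meet_comm[of _ B])
    ultimately show ?thesis
      by blast
  qed
qed

end
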